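(* Fix any integer $n\ge1$, any $\delta\in(e^{-n},1)$ and any measurable function $f:\mathbf{R}\to\mathbf{R}$ satisfying $f(0)=0$ and $\sup_{x\in\mathbf{R}}f(x)^2\ge1$. Then there exists a distribution $P_X$ on $\mathbf{R}$ such that for every estimator $\widehat g$ (possibly improper, i.e. not returning linear functions, and possibly depending on $P_X$) there is a choice $f_{\mathrm{reg}}\in\{f,-f\}$ such that, with $X\sim P_X$ and $Y=f_{\mathrm{reg}}(X)$, the following three conditions hold: (1) there exists $w^*\in\mathbf{R}$ such that $R(g_{w^*})=0$, where $g_w(x)=w\,x$; (2) $\mathbf{E}[Y^2]\le1$; (3) denoting $\|f_{\mathrm{reg}}\|_\infty=\sup_{x\in\mathbf{R}}|f_{\mathrm{reg}}(x)|=\|f\|_\infty\in[1,+\infty]$, $$\mathbf{P}\bigg(R(\widehat g)\ge\min\bigg(\frac{\|f_{\mathrm{reg}}\|_\infty^2\cdot\log(1/\delta)}{4n},\,1\bigg)\bigg)\ge\delta,$$ where $\widehat g$ is computed on an i.i.d. sample $(X_i,Y_i)_{i=1}^n$ of copies of $(X,Y)$.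
   Context: For measurable $g:\mathbf{R}\to\mathbf{R}$ the risk is $R(g)=\mathbf{E}(g(X)-Y)^2$, where $(X,Y)$ is independent of the sample; for a data-dependent $\widehat g$, $R(\widehat g)$ is the (random) risk conditional on the sample. An estimator is a measurable map from samples in $(\mathbf{R}\times\mathbf{R})^n$ to measurable functions $\mathbf{R}\to\mathbf{R}$. *)

theory Defs
  imports "HOL-Probability.Probability"
begin

text \<open>
  Expectations of nonnegative quantities, suprema and risks are taken in
  \<^typ>\<open>ennreal\<close>, so that infinite values are represented as such.
\<close>

definition sup_norm :: "(real \<Rightarrow> real) \<Rightarrow> ennreal" where
  "sup_norm h = (SUP x. ennreal \<bar>h x\<bar>)"

text \<open>The law of \<open>(X, h X)\<close> for \<open>X\<close> distributed according to \<open>PX\<close>.\<close>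

definition joint_law :: "real measure \<Rightarrow> (real \<Rightarrow> real) \<Rightarrow> (real \<times> real) measure" where
  "joint_law PX h = distr PX (borel \<Otimes>\<^sub>M borel) (\<lambda>x. (x, h x))"

definition risk :: "(real \<times> real) measure \<Rightarrow> (real \<Rightarrow> real) \<Rightarrow> ennreal" where
  "risk P g = (\<integral>\<^sup>+ (x, y). ennreal ((g x - y)\<^sup>2) \<partial>P)"

definition lin_fun :: "real \<Rightarrow> real \<Rightarrow> real" where
  "lin_fun w x = w * x"

text \<open>
  The set of Borel functions carries the \<open>\<sigma>\<close>-algebra generated by the point evaluations.
  Thus an estimator is a map \<open>g\<close> such that every \<open>g s\<close> is a Borel function and
  \<open>s \<mapsto> g s x\<close> is measurable for every \<open>x\<close>; in particular every \<open>g\<close> for which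
  \<open>(s, x) \<mapsto> g s x\<close> is jointly measurable is an estimator.
\<close>

definition borel_fun_space :: "(real \<Rightarrow> real) measure" where
  "borel_fun_space =
     restrict_space (\<Pi>\<^sub>M x\<in>(UNIV :: real set). (borel :: real measure)) (borel_measurable borel)"

definition estimators :: "nat \<Rightarrow> ((nat \<Rightarrow> real \<times> real) \<Rightarrow> real \<Rightarrow> real) set" where
  "estimators n = (\<Pi>\<^sub>M i\<in>{..<n}. borel \<Otimes>\<^sub>M borel) \<rightarrow>\<^sub>M borel_fun_space"

definition iid_sample :: "nat \<Rightarrow> (real \<times> real) measure \<Rightarrow> (nat \<Rightarrow> real \<times> real) measure" where
  "iid_sample n P = (\<Pi>\<^sub>M i\<in>{..<n}. P)"

end

theory Submission
  imports Defs
begin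

text \<open>
  Let \<open>PX\<close> put mass \<open>p\<close> on a point \<open>x\<close> where \<open>\<bar>f x\<bar>\<close> is nearly maximal, and mass \<open>1 - p\<close> on \<open>0\<close>.
  With probability \<open>(1 - p) ^ n\<close> the sample consists of the pair \<open>(0, 0)\<close> only, and then carries no
  information on the sign of the regression function. For one of the two signs, the prediction at
  \<open>x\<close> is off by at least \<open>\<bar>f x\<bar>\<close>, so that the risk is at least \<open>p * (f x)\<^sup>2\<close>. The choice
  \<open>p = min (ln (1 / \<delta>) / (2 * n)) (1 / (f x)\<^sup>2)\<close> makes \<open>(1 - p) ^ n \<ge> \<delta>\<close> and \<open>p * (f x)\<^sup>2 \<le> 1\<close>.
\<close>

section \<open>Choice of the point \<open>x\<close> and of its mass \<open>p\<close>\<close>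

lemma exp_minus_le_one_minus_half:
  fixes t :: real
  assumes "0 \<le> t" "t \<le> 1"
  shows "exp (- t) \<le> 1 - t / 2"
proof -
  \<comment> \<open>This is what makes \<open>(1 - t / 2) * (1 + t) = 1 + t * (1 - t) / 2\<close> at
    least 1; \<open>1 + t\<close> is then bounded by \<open>exp t\<close>.\<close>
  have "0 \<le> t * (1 - t)"
    using assms by simp
  then have "1 \<le> (1 - t / 2) * (1 + t)"
    by (simp add: algebra_simps)
  also have "\<dots> \<le> (1 - t / 2) * exp t"
    using assms by (intro mult_left_mono exp_ge_add_one_self) auto
  finally show ?thesis
    by (simp add: exp_minus field_simps)
qed

lemma sup_norm_uminus: "sup_norm (\<lambda>x. - f x) = sup_norm f"
  by (simp add: sup_norm_def)

text \<open>If every \<open>\<bar>f x\<bar>\<close> were below 1, squaring would only decrease it,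
  and the supremum of the squares would stay below 1 as well.\<close>

lemma one_le_sup_norm:
  assumes "(SUP x. ennreal ((f x)\<^sup>2)) \<ge> 1"
  shows "sup_norm f \<ge> 1"
proof (rule ccontr)
  assume "\<not> sup_norm f \<ge> 1"
  then have less: "sup_norm f < 1"
    by simp
  have "ennreal ((f x)\<^sup>2) \<le> sup_norm f" for x
  proof -
    have le: "ennreal \<bar>f x\<bar> \<le> sup_norm f"
      unfolding sup_norm_def by (rule SUP_upper) simp
    then have "\<bar>f x\<bar> < 1"
      using less by (metis ennreal_less_one_iff le_less_trans)
    then have "(f x)\<^sup>2 \<le> \<bar>f x\<bar>"
      by (metis abs_ge_zero less_imp_le mult_left_le power2_abs power2_eq_square)
    then show ?thesis
      using le by (meson ennreal_leI order_trans)
  qed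
  then have "(SUP x. ennreal ((f x)\<^sup>2)) \<le> sup_norm f"
    by (rule SUP_least)
  with assms less show False
    by simp
qed

text \<open>The supremum need not be attained. If it is infinite, some value exceeds any threshold,
  here \<open>sqrt K\<close>; if it is finite, some value exceeds it divided by
  \<open>sqrt 2\<close>, which costs a factor 2 after squaring.\<close>

lemma exists_near_sup_norm:
  assumes "sup_norm f \<ge> 1" "K > 0"
  obtains x where "f x \<noteq> 0"
    "(f x)\<^sup>2 \<ge> K \<or> (sup_norm f)\<^sup>2 \<le> ennreal (2 * (f x)\<^sup>2)"
proof (cases "sup_norm f = top")
  case True
  then have "ennreal (sqrt K) < sup_norm f"
    by simp
  then obtain x where "ennreal (sqrt K) < ennreal \<bar>f x\<bar>"
    unfolding sup_norm_def less_SUP_iff by blast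
  then have "sqrt K < \<bar>f x\<bar>"
    using assms by (simp add: ennreal_less_iff)
  then have "(sqrt K)\<^sup>2 < \<bar>f x\<bar>\<^sup>2"
    using assms by (intro power_strict_mono) auto
  then have "K < (f x)\<^sup>2"
    using assms by simp
  with that[of x] assms show ?thesis
    by force
next
  case False
  then obtain M where M: "sup_norm f = ennreal M" "M \<ge> 0"
    by (metis ennreal_cases)
  with assms have "M \<ge> 1"
    by (simp add: ennreal_ge_1)
  then have "M / sqrt 2 < M"
    by (simp add: field_simps)
  with M \<open>M \<ge> 1\<close> have "ennreal (M / sqrt 2) < sup_norm f"
    by (simp add: ennreal_less_iff)
  then obtain x where "ennreal (M / sqrt 2) < ennreal \<bar>f x\<bar>"
    unfolding sup_norm_def less_SUP_iff by blast
  then have less: "M / sqrt 2 < \<bar>f x\<bar>"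
    using M by (simp add: ennreal_less_iff)
  then have "(M / sqrt 2)\<^sup>2 \<le> \<bar>f x\<bar>\<^sup>2"
    using M by (intro power_mono) auto
  then have "M\<^sup>2 \<le> 2 * (f x)\<^sup>2"
    by (simp add: power_divide)
  then have "(sup_norm f)\<^sup>2 \<le> ennreal (2 * (f x)\<^sup>2)"
    using M by (simp add: ennreal_power ennreal_leI)
  moreover have "f x \<noteq> 0"
    using less M by (smt (verit) divide_nonneg_nonneg real_sqrt_ge_zero)
  ultimately show ?thesis
    using that by blast
qed

text \<open>The constant 4 is a product of two losses of a factor 2: one from
  \<open>exp (- t) \<le> 1 - t / 2\<close>, which forces \<open>p \<le> t / 2\<close>, and one from
  \<open>x\<close> being only nearly maximal.\<close>

lemma exists_mass:
  assumes "n \<ge> 1" "\<delta> \<in> {exp (- real n)<..<1}" "sup_norm f \<ge> 1"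
  obtains x p where "f x \<noteq> 0" "0 \<le> p" "p \<le> 1" "p * (f x)\<^sup>2 \<le> 1" "\<delta> \<le> (1 - p) ^ n"
    "min ((sup_norm f)\<^sup>2 * ennreal (ln (1 / \<delta>)) / ennreal (4 * real n)) 1 \<le> ennreal (p * (f x)\<^sup>2)"
proof -
  \<comment> \<open>The range of \<open>\<delta>\<close> is exactly the condition
    \<open>0 < t < 1\<close>, and \<open>\<delta>\<close> becomes the \<open>n\<close>-th power of
    \<open>exp (- t)\<close>, to be compared with \<open>(1 - p) ^ n\<close>.\<close>
  define t where "t = ln (1 / \<delta>) / n"
  have "\<delta> > 0"
    using assms(2) by (auto intro: less_trans[OF exp_gt_zero])
  moreover have "ln (exp (- real n)) < ln \<delta>"
    using assms(2) \<open>\<delta> > 0\<close> by (subst ln_less_cancel_iff) auto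
  ultimately have t: "0 < t" "t < 1" and L: "ln (1 / \<delta>) = n * t"
    using assms by (auto simp: t_def ln_div field_simps)
  have delta: "\<delta> = exp (- t) ^ n"
    using L \<open>\<delta> > 0\<close> by (simp add: ln_div flip: exp_of_nat_mult) (metis exp_ln minus_minus)
  \<comment> \<open>The threshold \<open>2 / t\<close> is the value of \<open>(f x)\<^sup>2\<close>
    from which on \<open>t / 2 * (f x)\<^sup>2\<close> is at least 1, so that the cap
    \<open>1 / (f x)\<^sup>2\<close> determines \<open>p\<close>.\<close>
  obtain x where x: "f x \<noteq> 0"
    "(f x)\<^sup>2 \<ge> 2 / t \<or> (sup_norm f)\<^sup>2 \<le> ennreal (2 * (f x)\<^sup>2)"
    using exists_near_sup_norm[OF assms(3), of "2 / t"] t by auto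
  define p where "p = min (t / 2) (1 / (f x)\<^sup>2)"
  have p: "0 \<le> p" "p \<le> 1" "p \<le> t / 2"
    using t by (auto simp: p_def)
  have pf: "p * (f x)\<^sup>2 = min (t / 2 * (f x)\<^sup>2) 1"
    using x(1) unfolding p_def by (auto simp: min_def field_simps)
  have "exp (- t) \<le> 1 - p"
    using exp_minus_le_one_minus_half[of t] t p by linarith
  then have "\<delta> \<le> (1 - p) ^ n"
    unfolding delta by (intro power_mono) auto
  moreover have "min ((sup_norm f)\<^sup>2 * ennreal (ln (1 / \<delta>)) / ennreal (4 * real n)) 1
      \<le> ennreal (p * (f x)\<^sup>2)"
  proof (cases "p * (f x)\<^sup>2 = 1")
    case True
    then show ?thesis
      by simp
  next
    case False
    \<comment> \<open>Here \<open>t / 2 * (f x)\<^sup>2 < 1\<close>, which excludes the first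
      alternative for \<open>x\<close>.\<close>
    with x(2) pf t have le: "(sup_norm f)\<^sup>2 \<le> ennreal (2 * (f x)\<^sup>2)" and eq: "p * (f x)\<^sup>2 = t / 2 * (f x)\<^sup>2"
      by (auto simp: min_def field_simps split: if_splits)
    have "(sup_norm f)\<^sup>2 * ennreal (ln (1 / \<delta>)) / ennreal (4 * real n)
        \<le> ennreal (2 * (f x)\<^sup>2) * ennreal (n * t) / ennreal (4 * real n)"
      unfolding L by (intro divide_right_mono_ennreal mult_right_mono le) simp
    also have "\<dots> = ennreal (2 * (f x)\<^sup>2 * (n * t) / (4 * real n))"
      using t assms(1) by (simp add: divide_ennreal flip: ennreal_mult)
    also have "\<dots> = ennreal (p * (f x)\<^sup>2)"
      using assms(1) unfolding eq by (simp add: field_simps)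
    finally show ?thesis
      by (simp add: min.coboundedI1)
  qed
  ultimately show thesis
    using that x(1) p pf by simp
qed

section \<open>The two-point distribution and its risk\<close>

definition two_point :: "real \<Rightarrow> real \<Rightarrow> real measure" where
  "two_point p x = distr (measure_pmf (bernoulli_pmf p)) borel (\<lambda>b. if b then x else 0)"

lemma real_distribution_two_point: "real_distribution (two_point p x)"
  unfolding two_point_def
  by (rule prob_space.real_distribution_distr) (auto intro: prob_space_measure_pmf)

lemma sets_joint_law [measurable_cong]: "sets (joint_law PX h) = sets (borel \<Otimes>\<^sub>M borel)"
  by (simp add: joint_law_def)

lemma nn_integral_joint_two_point:
  assumes [measurable]: "h \<in> borel_measurable borel" "u \<in> borel_measurable (borel \<Otimes>\<^sub>M borel)"
    and "h 0 = 0" "0 \<le> p" "p \<le> 1"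
  shows "(\<integral>\<^sup>+ z. u z \<partial>joint_law (two_point p x) h)
    = ennreal p * u (x, h x) + ennreal (1 - p) * u (0, 0)"
proof -
  have [measurable]: "(\<lambda>b. if b then x else 0) \<in> measure_pmf (bernoulli_pmf p) \<rightarrow>\<^sub>M borel"
    by simp
  have "(\<integral>\<^sup>+ z. u z \<partial>joint_law (two_point p x) h) =
      (\<integral>\<^sup>+ b. u (if b then x else 0, h (if b then x else 0)) \<partial>bernoulli_pmf p)"
    unfolding joint_law_def two_point_def by (simp add: nn_integral_distr)
  then show ?thesis
    using assms(3-) by (simp add: mult.commute)
qed

lemma risk_joint_two_point:
  assumes [measurable]: "h \<in> borel_measurable borel" "g \<in> borel_measurable borel"
    and "h 0 = 0" "0 \<le> p" "p \<le> 1"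
  shows "risk (joint_law (two_point p x) h) g
    = ennreal p * ennreal ((g x - h x)\<^sup>2) + ennreal (1 - p) * ennreal ((g 0)\<^sup>2)"
  unfolding risk_def using assms by (subst nn_integral_joint_two_point) auto

lemma prob_space_joint_two_point:
  assumes [measurable]: "h \<in> borel_measurable borel"
  shows "prob_space (joint_law (two_point p x) h)"
proof -
  interpret real_distribution "two_point p x"
    by (rule real_distribution_two_point)
  show ?thesis
    unfolding joint_law_def by (rule prob_space_distr) measurable
qed

section \<open>The all-zero sample and the lower bound on the risk\<close>

lemma sets_iid_sample:
  "sets (iid_sample n (joint_law PX h)) = sets (\<Pi>\<^sub>M i\<in>{..<n}. borel \<Otimes>\<^sub>M borel)"
  unfolding iid_sample_def by (rule sets_PiM_cong) (simp_all add: sets_joint_law)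

text \<open>Under a two-point law the risk depends only on the predictions at \<open>x\<close> and
  0, so measurable point evaluations make it a measurable function of the sample. That each
  prediction is a Borel function allows the squared loss to be integrated.\<close>

lemma estimators_measurable:
  assumes "ghat \<in> estimators n"
  shows "(\<lambda>s. ghat s x) \<in> (\<Pi>\<^sub>M i\<in>{..<n}. borel \<Otimes>\<^sub>M borel) \<rightarrow>\<^sub>M borel"
    and "s \<in> space (\<Pi>\<^sub>M i\<in>{..<n}. borel \<Otimes>\<^sub>M borel) \<Longrightarrow> ghat s \<in> borel_measurable borel"
proof -
  have *: "ghat \<in> (\<Pi>\<^sub>M i\<in>{..<n}. borel \<Otimes>\<^sub>M borel) \<rightarrow>\<^sub>M (\<Pi>\<^sub>M x\<in>UNIV. borel)"
    and **: "ghat \<in> space (\<Pi>\<^sub>M i\<in>{..<n}. borel \<Otimes>\<^sub>M borel) \<rightarrow> borel_measurable borel"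
    using assms unfolding estimators_def borel_fun_space_def measurable_restrict_space2_iff by auto
  show "(\<lambda>s. ghat s x) \<in> (\<Pi>\<^sub>M i\<in>{..<n}. borel \<Otimes>\<^sub>M borel) \<rightarrow>\<^sub>M borel"
    by (rule measurable_compose[OF * measurable_component_singleton]) simp
  show "s \<in> space (\<Pi>\<^sub>M i\<in>{..<n}. borel \<Otimes>\<^sub>M borel) \<Longrightarrow> ghat s \<in> borel_measurable borel"
    using ** by auto
qed

text \<open>Since \<open>x \<noteq> 0\<close>, the pair \<open>(x, h x)\<close> differs from
  \<open>(0, 0)\<close>, which therefore has mass exactly \<open>1 - p\<close>; independence gives
  the power.\<close>

lemma measure_iid_sample_zero:
  assumes [measurable]: "h \<in> borel_measurable borel" and "h 0 = 0" "x \<noteq> 0" "0 \<le> p" "p \<le> 1"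
  shows "measure (iid_sample n (joint_law (two_point p x) h)) {\<lambda>i\<in>{..<n}. (0, 0)} = (1 - p) ^ n"
proof -
  let ?J = "joint_law (two_point p x) h"
  interpret prob_space ?J
    by (rule prob_space_joint_two_point) fact
  interpret finite_product_prob_space "\<lambda>_. ?J" "{..<n}"
    by unfold_locales simp
  have [measurable]: "{(0, 0)} \<in> sets (borel \<Otimes>\<^sub>M borel :: (real \<times> real) measure)"
    using pair_measureI[of "{0::real}" borel "{0::real}" borel] by simp
  have "emeasure ?J {(0, 0)} = (\<integral>\<^sup>+ z. indicator {(0, 0)} z \<partial>?J)"
    by (simp add: sets_joint_law)
  also have "\<dots> = ennreal (1 - p)"
    using assms by (subst nn_integral_joint_two_point) auto
  finally have "measure ?J {(0, 0)} = 1 - p"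
    using assms by (simp add: measure_def)
  \<comment> \<open>Samples are extensional functions, undefined outside \<open>{..<n}\<close>, so a
    single sample is a box of singletons.\<close>
  moreover have "{\<lambda>i\<in>{..<n}. (0, 0)} = (\<Pi>\<^sub>E i\<in>{..<n}. {(0::real, 0::real)})"
    by (simp add: PiE_singleton restrict_def)
  moreover have "measure (PiM {..<n} (\<lambda>_. ?J)) (\<Pi>\<^sub>E i\<in>{..<n}. {(0, 0)})
      = (\<Prod>i<n. measure ?J {(0, 0)})"
    by (rule finite_measure_PiM_emb) (simp add: sets_joint_law)
  ultimately show ?thesis
    by (simp add: iid_sample_def)
qed

lemma risk_two_point_lower_bound:
  assumes h: "h \<in> borel_measurable borel" "h 0 = 0"
    and "x \<noteq> 0" "0 \<le> p" "p \<le> 1" and ghat: "ghat \<in> estimators n"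
    and opposite: "h x * ghat (\<lambda>i\<in>{..<n}. (0, 0)) x \<le> 0"
    and c: "c \<le> ennreal (p * (h x)\<^sup>2)"
  defines "J \<equiv> joint_law (two_point p x) h"
  shows "measure (iid_sample n J) {s \<in> space (iid_sample n J). risk J (ghat s) \<ge> c} \<ge> (1 - p) ^ n"
proof -
  let ?z = "\<lambda>i\<in>{..<n}. (0::real, 0::real)"
  let ?A = "{s \<in> space (iid_sample n J). risk J (ghat s) \<ge> c}"
  interpret prob_space J
    unfolding J_def by (rule prob_space_joint_two_point) fact
  interpret S: prob_space "iid_sample n J"
    unfolding iid_sample_def by (intro prob_space_PiM prob_space_axioms)
  have sets: "sets (iid_sample n J) = sets (\<Pi>\<^sub>M i\<in>{..<n}. borel \<Otimes>\<^sub>M borel)"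
    unfolding J_def by (rule sets_iid_sample)
  note space = sets_eq_imp_space_eq[OF sets]
  have risk: "risk J (ghat s) =
      ennreal p * ennreal ((ghat s x - h x)\<^sup>2) + ennreal (1 - p) * ennreal ((ghat s 0)\<^sup>2)"
    if "s \<in> space (iid_sample n J)" for s
    unfolding J_def using that assms(1-5) estimators_measurable(2)[OF ghat, of s, folded space]
    by (intro risk_joint_two_point) auto
  have [measurable]: "(\<lambda>s. ghat s y) \<in> borel_measurable (iid_sample n J)" for y
    using estimators_measurable(1)[OF ghat] by (simp add: measurable_cong_sets[OF sets refl])
  \<comment> \<open>Monotonicity of the measure below needs \<open>?A\<close> to be measurable; in
    this form it involves only two point evaluations.\<close>
  have "?A = {s \<in> space (iid_sample n J). ennreal p * ennreal ((ghat s x - h x)\<^sup>2)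
      + ennreal (1 - p) * ennreal ((ghat s 0)\<^sup>2) \<ge> c}"
    using risk by auto
  also have "\<dots> \<in> sets (iid_sample n J)"
    by measurable
  finally have A: "?A \<in> sets (iid_sample n J)" .
  have z: "?z \<in> space (iid_sample n J)"
    by (auto simp: space space_PiM space_pair_measure)
  \<comment> \<open>In the expanded square the cross term \<open>- 2 * ghat ?z x * h x\<close> is
    nonnegative by \<open>opposite\<close>.\<close>
  have "(h x)\<^sup>2 \<le> (ghat ?z x - h x)\<^sup>2"
    using mult.commute[of "h x" "ghat ?z x"] opposite zero_le_power2[of "ghat ?z x"]
    unfolding power2_diff mult.assoc by linarith
  then have "p * (h x)\<^sup>2 \<le> p * (ghat ?z x - h x)\<^sup>2"
    using assms by (simp add: mult_left_mono)
  then have "c \<le> ennreal p * ennreal ((ghat ?z x - h x)\<^sup>2)"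
    using c \<open>0 \<le> p\<close> by (auto simp: ennreal_leI intro: order_trans simp flip: ennreal_mult)
  then have "c \<le> risk J (ghat ?z)"
    unfolding risk[OF z] by (rule add_increasing2[rotated]) simp
  with z have "{?z} \<subseteq> ?A"
    by blast
  then have "measure (iid_sample n J) {?z} \<le> measure (iid_sample n J) ?A"
    by (rule S.finite_measure_mono) (rule A)
  then show ?thesis
    using measure_iid_sample_zero[OF h \<open>x \<noteq> 0\<close> \<open>0 \<le> p\<close> \<open>p \<le> 1\<close>] by (simp add: J_def)
qed

theorem proposition2:
  fixes n :: nat and \<delta> :: real and f :: "real \<Rightarrow> real"
  assumes "n \<ge> 1"
    and "\<delta> \<in> {exp (- real n)<..<1}"
    and "f \<in> borel_measurable borel"
    and "f 0 = 0"
    and "(SUP x. ennreal ((f x)\<^sup>2)) \<ge> 1"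
  shows "\<exists>PX. real_distribution PX \<and>
    (\<forall>ghat \<in> estimators n. \<exists>freg \<in> {f, \<lambda>x. - f x}.
      (\<exists>w. risk (joint_law PX freg) (lin_fun w) = 0) \<and>
      (\<integral>\<^sup>+ (x, y). ennreal (y\<^sup>2) \<partial>joint_law PX freg) \<le> 1 \<and>
      sup_norm freg = sup_norm f \<and> sup_norm f \<ge> 1 \<and>
      measure (iid_sample n (joint_law PX freg))
        {s \<in> space (iid_sample n (joint_law PX freg)).
           risk (joint_law PX freg) (ghat s)
             \<ge> min ((sup_norm freg)\<^sup>2 * ennreal (ln (1 / \<delta>)) / ennreal (4 * real n)) 1}
        \<ge> \<delta>)"
proof -
  have sup: "sup_norm f \<ge> 1"
    using assms(5) by (rule one_le_sup_norm)
  obtain x p where x: "f x \<noteq> 0" and p: "0 \<le> p" "p \<le> 1" and pf: "p * (f x)\<^sup>2 \<le> 1"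
    and delta: "\<delta> \<le> (1 - p) ^ n"
    and bound: "min ((sup_norm f)\<^sup>2 * ennreal (ln (1 / \<delta>)) / ennreal (4 * real n)) 1
      \<le> ennreal (p * (f x)\<^sup>2)"
    using exists_mass[OF assms(1,2) sup] by blast
  have "x \<noteq> 0"
    using x assms(4) by auto
  show ?thesis
  proof (intro exI conjI ballI)
    \<comment> \<open>This fixes the witness for \<open>PX\<close>; it is built from
      \<open>f\<close>, \<open>n\<close> and \<open>\<delta>\<close> alone, before the estimator is
      given.\<close>
    show "real_distribution (two_point p x)"
      by (rule real_distribution_two_point)
  next
    fix ghat assume ghat: "ghat \<in> estimators n"
    \<comment> \<open>The all-zero sample is the same for both signs because \<open>f 0 = 0\<close>,
      so the prediction there is a fixed number, and the sign can be chosen against it.\<close>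
    obtain h where h: "h \<in> {f, \<lambda>x. - f x}" "h x * ghat (\<lambda>i\<in>{..<n}. (0, 0)) x \<le> 0"
    proof (cases "f x * ghat (\<lambda>i\<in>{..<n}. (0, 0)) x \<le> 0")
      case True
      then show ?thesis using that[of f] by simp
    next
      case False
      then show ?thesis using that[of "\<lambda>x. - f x"] by simp
    qed
    have meas [measurable]: "h \<in> borel_measurable borel" and h0: "h 0 = 0"
      and hx: "(h x)\<^sup>2 = (f x)\<^sup>2" and norm: "sup_norm h = sup_norm f"
      using h(1) assms(3,4) by (auto simp: sup_norm_uminus)
    have lin: "lin_fun w \<in> borel_measurable borel" for w
      unfolding lin_fun_def[abs_def] by measurable
    \<comment> \<open>The line through the origin and \<open>(x, h x)\<close> agrees with
      \<open>h\<close> on the whole support.\<close>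
    have "risk (joint_law (two_point p x) h) (lin_fun (h x / x)) = 0"
      using \<open>x \<noteq> 0\<close> risk_joint_two_point[OF meas lin h0 p] by (simp add: lin_fun_def)
    \<comment> \<open>The second moment is \<open>p * (f x)\<^sup>2\<close>, as
      \<open>h 0 = 0\<close>; the cap on \<open>p\<close> keeps it at most 1.\<close>
    moreover have "(\<integral>\<^sup>+ (x, y). ennreal (y\<^sup>2) \<partial>joint_law (two_point p x) h) \<le> 1"
      using pf p h0 hx
      by (subst nn_integral_joint_two_point) (auto simp flip: ennreal_mult)
    moreover note risk_two_point_lower_bound[OF meas h0 \<open>x \<noteq> 0\<close> p ghat h(2) bound[folded hx]]
    ultimately show "\<exists>freg \<in> {f, \<lambda>x. - f x}.
      (\<exists>w. risk (joint_law (two_point p x) freg) (lin_fun w) = 0) \<and>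
      (\<integral>\<^sup>+ (x, y). ennreal (y\<^sup>2) \<partial>joint_law (two_point p x) freg) \<le> 1 \<and>
      sup_norm freg = sup_norm f \<and> sup_norm f \<ge> 1 \<and>
      measure (iid_sample n (joint_law (two_point p x) freg))
        {s \<in> space (iid_sample n (joint_law (two_point p x) freg)).
           risk (joint_law (two_point p x) freg) (ghat s)
             \<ge> min ((sup_norm freg)\<^sup>2 * ennreal (ln (1 / \<delta>)) / ennreal (4 * real n)) 1}
        \<ge> \<delta>"
      using sup norm delta h(1) by (intro bexI[of _ h]) auto
  qed
qed

end
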